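(* The function $\mu : \mathbb{N} \to \mathbb{N}$ is unbounded.
   Context: $\mathbb{N}$ denotes the set of positive integers. Fix an infinite set $D_0$ and recursively let $D_{n+1}$ be the set of finite non-empty subsets of $D_n$, for $n \geq 0$. For $k \geq 1$ and $n \geq 0$, define a set $\mathcal{F}^{(k)}_n$ of functions $D_0^k \to D_n$ by recursion on $n$: $\mathcal{F}^{(k)}_0$ is the set of the $k$ projections $(x_1,\dots,x_k) \mapsto x_i$ ($1 \leq i \leq k$); and $\mathcal{F}^{(k)}_{n+1}$ is the set of those functions $D_0^k \to D_{n+1}$ of the form $\mathbf{x} \mapsto \{g(\mathbf{x}) : g \in \mathcal{G}\}$ for some non-empty $\mathcal{G} \subseteq \mathcal{F}^{(k)}_n$. A pair $(k,n) \in \mathbb{N} \times \mathbb{N}$ is called good if $\mathcal{F}^{(k)}_n$ contains an injective function. For $k \in \mathbb{N}$, $\mu(k)$ is the least $n \in \mathbb{N}$ such that $(k,n)$ is good (for every $k \in \mathbb{N}$ such an $n$ exists, so $\mu$ is well-defined). *)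

theory Defs
  imports Main "HOL-Library.FSet" "HOL-Library.FuncSet"
begin

text \<open>Iterated finite sets over atoms of type \<open>'a\<close>. The constructor \<open>Atom\<close> keeps the elements of
  \<open>D\<^sub>0\<close> apart from the sets built over them, so that all the \<open>D\<^sub>n\<close> live in a single type.\<close>

datatype 'a fin_hier = Atom 'a | Coll "'a fin_hier fset"

fun elems :: "'a fin_hier \<Rightarrow> 'a fin_hier set" where
  "elems (Atom a) = {}"
| "elems (Coll S) = fset S"

primrec level :: "'a set \<Rightarrow> nat \<Rightarrow> 'a fin_hier set" where
  "level D0 0 = Atom ` D0"
| "level D0 (Suc n) = {Coll S |S. S \<noteq> {||} \<and> fset S \<subseteq> level D0 n}"

definition tuples :: "'a set \<Rightarrow> nat \<Rightarrow> (nat \<Rightarrow> 'a) set" where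
  "tuples D0 k = ({1..k} \<rightarrow>\<^sub>E D0)"

text \<open>Functions on \<open>D\<^sub>0\<^sup>k\<close> are extensional, i.e. equal to \<open>undefined\<close> outside \<open>tuples D0 k\<close>, so that
  equality in \<open>\<F> D0 k n\<close> is equality of functions on \<open>D\<^sub>0\<^sup>k\<close>.\<close>

primrec \<F> :: "'a set \<Rightarrow> nat \<Rightarrow> nat \<Rightarrow> ((nat \<Rightarrow> 'a) \<Rightarrow> 'a fin_hier) set" where
  "\<F> D0 k 0 = {\<lambda>x\<in>tuples D0 k. Atom (x i) |i. i \<in> {1..k}}"
| "\<F> D0 k (Suc n) =
     {f \<in> tuples D0 k \<rightarrow>\<^sub>E level D0 (Suc n).
        \<exists>G. G \<noteq> {} \<and> G \<subseteq> \<F> D0 k n \<and> (\<forall>x\<in>tuples D0 k. elems (f x) = {g x |g. g \<in> G})}"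

definition good :: "'a set \<Rightarrow> nat \<Rightarrow> nat \<Rightarrow> bool" where
  "good D0 k n \<longleftrightarrow> 1 \<le> k \<and> 1 \<le> n \<and> (\<exists>f\<in>\<F> D0 k n. inj_on f (tuples D0 k))"

text \<open>Meaningful for \<open>k \<ge> 1\<close> only; see \<open>good_exists\<close> below.\<close>

definition \<mu> :: "'a set \<Rightarrow> nat \<Rightarrow> nat" where
  "\<mu> D0 k = (LEAST n. good D0 k n)"

lemma \<F>_funcset: "f \<in> \<F> D0 k n \<Longrightarrow> f \<in> tuples D0 k \<rightarrow>\<^sub>E level D0 n"
  by (cases n) (auto simp: tuples_def PiE_iff)

lemma \<F>_pair:
  assumes "f \<in> \<F> D0 k n" "g \<in> \<F> D0 k n"
  shows "(\<lambda>x\<in>tuples D0 k. Coll {|f x, g x|}) \<in> \<F> D0 k (Suc n)"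
proof -
  have "(\<lambda>x\<in>tuples D0 k. Coll {|f x, g x|}) \<in> tuples D0 k \<rightarrow>\<^sub>E level D0 (Suc n)"
    using \<F>_funcset[OF assms(1)] \<F>_funcset[OF assms(2)] by (auto simp: PiE_iff)
  moreover have "\<forall>x\<in>tuples D0 k. elems ((\<lambda>x\<in>tuples D0 k. Coll {|f x, g x|}) x) = {h x |h. h \<in> {f, g}}"
    by auto
  ultimately show ?thesis
    using assms unfolding \<F>.simps by (intro CollectI conjI exI[of _ "{f, g}"]) auto
qed

lemma \<F>_coordinate:
  assumes "i \<in> {1..k}"
  shows "\<exists>g\<in>\<F> D0 k n. \<forall>x\<in>tuples D0 k. \<forall>y\<in>tuples D0 k. g x = g y \<longrightarrow> x i = y i"
proof (induction n)
  case 0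
  show ?case
    using assms by (intro bexI[of _ "\<lambda>x\<in>tuples D0 k. Atom (x i)"]) auto
next
  case (Suc n)
  then obtain g where "g \<in> \<F> D0 k n"
    and "\<forall>x\<in>tuples D0 k. \<forall>y\<in>tuples D0 k. g x = g y \<longrightarrow> x i = y i" by blast
  then show ?case
    by (intro bexI[OF _ \<F>_pair[of g D0 k n g]]) auto
qed

lemma kuratowski_fset_inject:
  assumes "{|Coll {|a, a|}, Coll {|a, b|}|} = {|Coll {|c, c|}, Coll {|c, d|}|}"
  shows "a = c \<and> b = d"
  using assms by (auto simp: fdoubleton_eq_iff)

lemma \<F>_initial_coordinates:
  assumes "1 \<le> j" "j \<le> k"
  shows "\<exists>n\<ge>1. \<exists>f\<in>\<F> D0 k n. \<forall>x\<in>tuples D0 k. \<forall>y\<in>tuples D0 k.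
           f x = f y \<longrightarrow> (\<forall>i\<in>{1..j}. x i = y i)"
  using assms
proof (induction j rule: dec_induct)
  case base
  then have "(1::nat) \<in> {1..k}" by simp
  from \<F>_coordinate[OF this, of D0 1] obtain f where f: "f \<in> \<F> D0 k 1"
    and f_inj: "\<forall>x\<in>tuples D0 k. \<forall>y\<in>tuples D0 k. f x = f y \<longrightarrow> x 1 = y 1" ..
  have "\<forall>x\<in>tuples D0 k. \<forall>y\<in>tuples D0 k. f x = f y \<longrightarrow> (\<forall>i\<in>{1..1}. x i = y i)"
    using f_inj by simp
  with f show ?case
    by (intro exI[of _ 1] conjI order_refl bexI[of _ f])
next
  case (step j)
  have "j \<le> k" using step.prems by simp
  from step.IH[OF this] obtain n f where f: "f \<in> \<F> D0 k n"
    and f_inj: "\<forall>x\<in>tuples D0 k. \<forall>y\<in>tuples D0 k. f x = f y \<longrightarrow> (\<forall>i\<in>{1..j}. x i = y i)"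
    by (elim exE conjE bexE)
  have "Suc j \<in> {1..k}" using step.prems by simp
  from \<F>_coordinate[OF this, of D0 n] obtain g where g: "g \<in> \<F> D0 k n"
    and g_inj: "\<forall>x\<in>tuples D0 k. \<forall>y\<in>tuples D0 k. g x = g y \<longrightarrow> x (Suc j) = y (Suc j)" ..
  define h where "h = (\<lambda>x\<in>tuples D0 k. Coll {|(\<lambda>x\<in>tuples D0 k. Coll {|f x, f x|}) x,
                                             (\<lambda>x\<in>tuples D0 k. Coll {|f x, g x|}) x|})"
  have h: "h \<in> \<F> D0 k (Suc (Suc n))"
    unfolding h_def by (intro \<F>_pair f g)
  have h_inj: "\<forall>i\<in>{1..Suc j}. x i = y i"
    if xy: "x \<in> tuples D0 k" "y \<in> tuples D0 k" and "h x = h y" for x y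
  proof -
    have "{|Coll {|f x, f x|}, Coll {|f x, g x|}|} = {|Coll {|f y, f y|}, Coll {|f y, g y|}|}"
      using \<open>h x = h y\<close> xy
      by (simp only: h_def restrict_apply' fin_hier.inject)
    from kuratowski_fset_inject[OF this] have eq: "f x = f y" "g x = g y" by simp_all
    have "\<forall>i\<in>{1..j}. x i = y i" using f_inj[rule_format, OF xy eq(1)] by simp
    moreover have "x (Suc j) = y (Suc j)" by (rule g_inj[rule_format, OF xy eq(2)])
    ultimately show ?thesis by (simp add: atLeastAtMostSuc_conv)
  qed
  show ?case
  proof (intro exI[of _ "Suc (Suc n)"] conjI)
    show "1 \<le> Suc (Suc n)" by simp
    show "\<exists>f\<in>\<F> D0 k (Suc (Suc n)). \<forall>x\<in>tuples D0 k. \<forall>y\<in>tuples D0 k.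
            f x = f y \<longrightarrow> (\<forall>i\<in>{1..Suc j}. x i = y i)"
      by (rule bexI[OF _ h], intro ballI[of "tuples D0 k"] impI, rule h_inj)
  qed
qed

lemma good_exists:
  assumes "1 \<le> k"
  shows "\<exists>n. good D0 k n"
proof -
  obtain n f where "n \<ge> 1" "f \<in> \<F> D0 k n" and f_inj: "\<forall>x\<in>tuples D0 k. \<forall>y\<in>tuples D0 k.
           f x = f y \<longrightarrow> (\<forall>i\<in>{1..k}. x i = y i)"
    using \<F>_initial_coordinates[OF assms order_refl] by blast
  moreover have "inj_on f (tuples D0 k)"
  proof (rule inj_onI)
    fix x y assume xy: "x \<in> tuples D0 k" "y \<in> tuples D0 k" and "f x = f y"
    then have "\<And>i. i \<in> {1..k} \<Longrightarrow> x i = y i"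
      using f_inj by blast
    then show "x = y"
      by (rule PiE_ext[OF xy[unfolded tuples_def]])
  qed
  ultimately show ?thesis
    using assms unfolding good_def by blast
qed

end

theory Submission
  imports Defs
begin

text \<open>The proof is a count. Every function in \<open>\<F> D0 k n\<close> is assembled from projections, so it maps
  tuples over a two-element set \<open>A \<subseteq> D0\<close> to objects built over \<open>A\<close> alone
  (\<open>\<F>_tuples_subset\<close>). There are only finitely many such objects of rank \<open>n\<close>, and their number does
  not depend on \<open>k\<close> (\<open>finite_level\<close>), whereas \<open>A\<close> has \<open>2 ^ k\<close> tuples of length \<open>k\<close>. By the
  pigeonhole principle a bound on \<open>\<mu>\<close> by \<open>N\<close> is violated as soon as \<open>k\<close> reaches the number of
  objects of rank at most \<open>N\<close> over \<open>A\<close>, because \<open>k < 2 ^ k\<close>.\<close>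

lemma finite_level:
  assumes "finite A"
  shows "finite (level A n)"
proof (induction n)
  case 0
  show ?case using assms by simp
next
  case (Suc n)
  have "level A (Suc n) \<subseteq> Coll ` {S. fset S \<subseteq> level A n}" by auto
  moreover have "finite {S. fset S \<subseteq> level A n}"
  proof (rule finite_imageD)
    show "finite (fset ` {S. fset S \<subseteq> level A n})"
      by (rule finite_subset[of _ "Pow (level A n)"]) (use Suc.IH in auto)
    show "inj_on fset {S. fset S \<subseteq> level A n}"
      by (simp add: inj_on_def fset_inject)
  qed
  ultimately show ?case by (meson finite_imageI finite_subset)
qed

lemma tuples_mono: "A \<subseteq> B \<Longrightarrow> tuples A k \<subseteq> tuples B k"
  unfolding tuples_def by (rule PiE_mono)

lemma \<F>_tuples_subset:
  assumes "A \<subseteq> D0" "f \<in> \<F> D0 k n" "x \<in> tuples A k"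
  shows "f x \<in> level A n"
  using assms(2)
proof (induction n arbitrary: f)
  case 0
  have "x \<in> tuples D0 k" using tuples_mono[OF assms(1)] assms(3) by blast
  with 0 assms(3) show ?case by (auto simp: tuples_def PiE_iff)
next
  case (Suc n)
  have x: "x \<in> tuples D0 k" using tuples_mono[OF assms(1)] assms(3) by blast
  from Suc.prems obtain G where G: "G \<subseteq> \<F> D0 k n"
    and "\<forall>x\<in>tuples D0 k. elems (f x) = {g x |g. g \<in> G}"
    unfolding \<F>.simps by blast
  with x have elems: "elems (f x) = {g x |g. g \<in> G}" by (elim bspec)
  have f: "f x \<in> level D0 (Suc n)"
    using \<F>_funcset[OF Suc.prems] x by (rule PiE_mem)
  from f obtain S where S: "f x = Coll S" "S \<noteq> {||}" by auto
  have "fset S \<subseteq> level A n" using G elems S(1) Suc.IH by auto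
  with S show ?case by simp
qed

lemma good_imp_power_le_card_level:
  assumes "good D0 k n" "A \<subseteq> D0" "finite A"
  shows "card A ^ k \<le> card (level A n)"
proof -
  from assms(1) obtain f where f: "f \<in> \<F> D0 k n" "inj_on f (tuples D0 k)"
    unfolding good_def by blast
  have "inj_on f (tuples A k)"
    using f(2) tuples_mono[OF assms(2)] by (rule inj_on_subset)
  moreover have "f ` tuples A k \<subseteq> level A n"
    using \<F>_tuples_subset[OF assms(2) f(1)] by blast
  ultimately have "card (tuples A k) \<le> card (level A n)"
    using card_inj_on_le finite_level[OF assms(3)] by blast
  then show ?thesis by (simp add: tuples_def card_PiE)
qed

theorem theorem3p2:
  fixes D0 :: "'a set"
  assumes "infinite D0"
  shows "\<not> bdd_above (\<mu> D0 ` {1..})"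
proof
  assume "bdd_above (\<mu> D0 ` {1..})"
  then obtain N where N: "\<And>k. 1 \<le> k \<Longrightarrow> \<mu> D0 k \<le> N"
    by (auto simp: bdd_above_def)
  from assms obtain A where A: "A \<subseteq> D0" "finite A" "card A = 2"
    using infinite_arbitrarily_large by blast
  \<comment> \<open>The summand 1 keeps the exponent in the range \<open>k \<ge> 1\<close> on which \<open>\<mu>\<close> is bounded.\<close>
  define k where "k = Suc (\<Sum>m\<le>N. card (level A m))"
  have k: "1 \<le> k" by (simp add: k_def)
  have "good D0 k (\<mu> D0 k)"
    unfolding \<mu>_def using good_exists[OF k] by (rule LeastI_ex)
  from good_imp_power_le_card_level[OF this A(1,2)]
  have "2 ^ k \<le> card (level A (\<mu> D0 k))" by (simp add: A(3))
  also have "\<dots> \<le> (\<Sum>m\<le>N. card (level A m))"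
    by (rule member_le_sum) (use N[OF k] in auto)
  also have "\<dots> < k" by (simp add: k_def)
  finally show False using less_exp[of k] by simp
qed

end
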